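(* Let $(\Omega,\mathcal{A},T,\mu,\mathcal{F},\|\cdot\|,\chi)$ fulfill Property $\mathfrak{D}$, where $\chi$ is non-integrable, i.e. $\int\chi\,\mathrm{d}\mu=\infty$. Then there exist a sequence of natural numbers $(b_n)_{n\in\mathbb{N}}$ with $b_n=o(n)$ and a sequence of positive reals $(d_n)_{n\in\mathbb{N}}$ such that $$\lim_{n\to\infty}\frac{\mathsf{S}_n^{b_n}\chi}{d_n}=1\quad\mu\text{-almost surely.}$$
   Context: Transfer operator. For a non-singular transformation $T$ of a probability space $(\Omega,\mathcal{A},\mu)$, $\widehat T:\mathcal{L}^1\to\mathcal{L}^1$ is the unique operator with $\int \widehat T f\cdot g\,\mathrm{d}\mu=\int f\cdot g\circ T\,\mathrm{d}\mu$ for all $f\in\mathcal{L}^1$, $g\in\mathcal{L}^\infty$. $|\cdot|_\infty$ is the $\mathcal{L}^\infty$ norm. Spectral gap. A bounded linear operator $U$ on a Banach space has a spectral gap if $U=\lambda P+N$ with $\lambda\in\mathbb{C}$ and $P,N$ bounded linear operators such that $P^2=P$, $\dim \mathrm{Im}(P)=1$, $\rho(N)<|\lambda|$ ($\rho$ = spectral radius), and $PN=NP=0$. Property $\mathfrak{C}$. Let $\mathcal{F}$ be a subset of the measurable functions forming a Banach algebra with respect to a norm $\|\cdot\|$. $(\Omega,\mathcal{A},T,\mu,\mathcal{F},\|\cdot\|)$ has Property $\mathfrak{C}$ if: $\mu$ is a $T$-invariant, mixing probability measure; $\mathcal{F}$ contains the constant functions and $\|f\|\ge|f|_\infty$ for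 all $f\in\mathcal{F}$; there is $K_0>0$ with $\|\widehat T f\|\le K_0\|f\|$ for all $f\in\mathcal{F}$; $\widehat T$ has a spectral gap on $\mathcal{F}$ with respect to $\|\cdot\|$. Property $\mathfrak{D}$. Let $\chi:\Omega\to\mathbb{R}_{\ge0}$ be measurable and ${}^{\ell}\chi:=\chi\cdot\mathbb{1}_{\{\chi\le\ell\}}$ for $\ell\ge0$. $(\Omega,\mathcal{A},T,\mu,\mathcal{F},\|\cdot\|,\chi)$ has Property $\mathfrak{D}$ if $(\Omega,\mathcal{A},T,\mu,\mathcal{F},\|\cdot\|)$ has Property $\mathfrak{C}$ and there are $K_1,K_2>0$ such that for all $\ell>0$: $\|{}^{\ell}\chi\|\le K_1\ell$ and $\|\mathbb{1}_{\{\chi>\ell\}}\|\le K_2$. Trimmed sums. For each $n$ (and each point of $\Omega$) choose a permutation $\sigma$ of $\{0,\dots,n-1\}$ with $\chi\circ T^{\sigma(0)}\ge\chi\circ T^{\sigma(1)}\ge\dots\ge\chi\circ T^{\sigma(n-1)}$; for $b_n\in\mathbb{N}_0$ put $\mathsf{S}_n^{b_n}\chi:=\sum_{k=b_n}^{n-1}\chi\circ T^{\sigma(k)}$, i.e. the Birkhoff sum with the $b_n$ largest terms removed. *)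

theory Defs
  imports
    "HOL-Probability.Probability"
    "HOL-Library.Landau_Symbols"
    "HOL-Combinatorics.Permutations"
begin

definition Linf_norm :: "'a measure \<Rightarrow> ('a \<Rightarrow> complex) \<Rightarrow> ereal" where
  "Linf_norm M f = esssup M (\<lambda>x. ereal (norm (f x)))"

text \<open>
  Elements of a function space are classes of measurable functions modulo equality almost
  everywhere.  Such a space is represented by the set \<open>F\<close> of all representatives, so \<open>F\<close> is
  saturated under almost everywhere equality and \<open>nrm f = 0\<close> means that \<open>f\<close> vanishes almost
  everywhere.  All identities between elements of \<open>F\<close> are identities almost everywhere.
\<close>

definition function_banach_algebra ::
  "'a measure \<Rightarrow> ('a \<Rightarrow> complex) set \<Rightarrow> (('a \<Rightarrow> complex) \<Rightarrow> real) \<Rightarrow> bool" where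
  "function_banach_algebra M F nrm \<longleftrightarrow>
     F \<subseteq> borel_measurable M \<and>
     (\<forall>f\<in>F. \<forall>g\<in>borel_measurable M. (AE x in M. f x = g x) \<longrightarrow> g \<in> F) \<and>
     (\<lambda>_. 0) \<in> F \<and>
     (\<forall>f\<in>F. \<forall>g\<in>F. (\<lambda>x. f x + g x) \<in> F) \<and>
     (\<forall>c. \<forall>f\<in>F. (\<lambda>x. c * f x) \<in> F) \<and>
     (\<forall>f\<in>F. \<forall>g\<in>F. (\<lambda>x. f x * g x) \<in> F) \<and>
     (\<forall>f\<in>F. 0 \<le> nrm f) \<and>
     (\<forall>f\<in>F. nrm f = 0 \<longleftrightarrow> (AE x in M. f x = 0)) \<and>
     (\<forall>c. \<forall>f\<in>F. nrm (\<lambda>x. c * f x) = norm c * nrm f) \<and>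
     (\<forall>f\<in>F. \<forall>g\<in>F. nrm (\<lambda>x. f x + g x) \<le> nrm f + nrm g) \<and>
     (\<forall>f\<in>F. \<forall>g\<in>F. nrm (\<lambda>x. f x * g x) \<le> nrm f * nrm g) \<and>
     (\<forall>u. (\<forall>n. u n \<in> F) \<and>
          (\<forall>e>0. \<exists>n0. \<forall>m\<ge>n0. \<forall>n\<ge>n0. nrm (\<lambda>x. u m x - u n x) < e) \<longrightarrow>
          (\<exists>f\<in>F. (\<lambda>n::nat. nrm (\<lambda>x. u n x - f x)) \<longlonglongrightarrow> 0))"

text \<open>
  Boundedness and linearity together make \<open>U\<close> compatible with almost everywhere equality on \<open>F\<close>.
\<close>

definition bounded_operator_on ::
  "'a measure \<Rightarrow> ('a \<Rightarrow> complex) set \<Rightarrow> (('a \<Rightarrow> complex) \<Rightarrow> real) \<Rightarrow>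
   (('a \<Rightarrow> complex) \<Rightarrow> ('a \<Rightarrow> complex)) \<Rightarrow> bool" where
  "bounded_operator_on M F nrm U \<longleftrightarrow>
     (\<forall>f\<in>F. U f \<in> F) \<and>
     (\<forall>f\<in>F. \<forall>g\<in>F. AE x in M. U (\<lambda>y. f y + g y) x = U f x + U g x) \<and>
     (\<forall>c. \<forall>f\<in>F. AE x in M. U (\<lambda>y. c * f y) x = c * U f x) \<and>
     (\<exists>K. \<forall>f\<in>F. nrm (U f) \<le> K * nrm f)"

definition op_spectrum ::
  "'a measure \<Rightarrow> ('a \<Rightarrow> complex) set \<Rightarrow> (('a \<Rightarrow> complex) \<Rightarrow> real) \<Rightarrow>
   (('a \<Rightarrow> complex) \<Rightarrow> ('a \<Rightarrow> complex)) \<Rightarrow> complex set" where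
  "op_spectrum M F nrm U =
     {z. \<not> (\<exists>R. bounded_operator_on M F nrm R \<and>
             (\<forall>f\<in>F. AE x in M. R (\<lambda>y. z * f y - U f y) x = f x) \<and>
             (\<forall>f\<in>F. AE x in M. z * R f x - U (R f) x = f x))}"

text \<open>
  For a bounded operator on a nonzero space the spectrum is nonempty and bounded, so the
  supremum over the reals is the genuine one.
\<close>

definition op_spectral_radius ::
  "'a measure \<Rightarrow> ('a \<Rightarrow> complex) set \<Rightarrow> (('a \<Rightarrow> complex) \<Rightarrow> real) \<Rightarrow>
   (('a \<Rightarrow> complex) \<Rightarrow> ('a \<Rightarrow> complex)) \<Rightarrow> real" where
  "op_spectral_radius M F nrm U = Sup (norm ` op_spectrum M F nrm U)"

text \<open>The image of \<open>P\<close>, modulo almost everywhere equality, is spanned by one nonzero element.\<close>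

definition one_dim_image ::
  "'a measure \<Rightarrow> ('a \<Rightarrow> complex) set \<Rightarrow> (('a \<Rightarrow> complex) \<Rightarrow> ('a \<Rightarrow> complex)) \<Rightarrow> bool" where
  "one_dim_image M F P \<longleftrightarrow>
     (\<exists>g\<in>F. \<not> (AE x in M. P g x = 0) \<and>
            (\<forall>f\<in>F. \<exists>c. AE x in M. P f x = c * P g x))"

definition has_spectral_gap ::
  "'a measure \<Rightarrow> ('a \<Rightarrow> complex) set \<Rightarrow> (('a \<Rightarrow> complex) \<Rightarrow> real) \<Rightarrow>
   (('a \<Rightarrow> complex) \<Rightarrow> ('a \<Rightarrow> complex)) \<Rightarrow> bool" where
  "has_spectral_gap M F nrm U \<longleftrightarrow>
     bounded_operator_on M F nrm U \<and>
     (\<exists>\<zeta> P N.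
        bounded_operator_on M F nrm P \<and>
        bounded_operator_on M F nrm N \<and>
        (\<forall>f\<in>F. AE x in M. U f x = \<zeta> * P f x + N f x) \<and>
        (\<forall>f\<in>F. AE x in M. P (P f) x = P f x) \<and>
        one_dim_image M F P \<and>
        op_spectral_radius M F nrm N < norm \<zeta> \<and>
        (\<forall>f\<in>F. AE x in M. P (N f) x = 0) \<and>
        (\<forall>f\<in>F. AE x in M. N (P f) x = 0))"

text \<open>
  The transfer operator is determined by its defining identity up to almost everywhere equality;
  the choice operator picks a representative.
\<close>

definition transfer_operator ::
  "'a measure \<Rightarrow> ('a \<Rightarrow> 'a) \<Rightarrow> ('a \<Rightarrow> complex) \<Rightarrow> 'a \<Rightarrow> complex" where
  "transfer_operator M T f =
     (SOME h. integrable M h \<and>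
        (\<forall>g\<in>borel_measurable M. Linf_norm M g < \<infinity> \<longrightarrow>
           (\<integral>x. h x * g x \<partial>M) = (\<integral>x. f x * g (T x) \<partial>M)))"

definition invariant_measure :: "'a measure \<Rightarrow> ('a \<Rightarrow> 'a) \<Rightarrow> bool" where
  "invariant_measure M T \<longleftrightarrow> T \<in> measurable M M \<and> distr M M T = M"

definition mixing :: "'a measure \<Rightarrow> ('a \<Rightarrow> 'a) \<Rightarrow> bool" where
  "mixing M T \<longleftrightarrow>
     (\<forall>A\<in>sets M. \<forall>B\<in>sets M.
        (\<lambda>n. measure M (A \<inter> ((T ^^ n) -` B \<inter> space M))) \<longlonglongrightarrow> measure M A * measure M B)"

definition property_C ::
  "'a measure \<Rightarrow> ('a \<Rightarrow> 'a) \<Rightarrow> ('a \<Rightarrow> complex) set \<Rightarrow> (('a \<Rightarrow> complex) \<Rightarrow> real) \<Rightarrow> bool" where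
  "property_C M T F nrm \<longleftrightarrow>
     function_banach_algebra M F nrm \<and>
     prob_space M \<and> invariant_measure M T \<and> mixing M T \<and>
     (\<forall>c. (\<lambda>_. c) \<in> F) \<and>
     (\<forall>f\<in>F. Linf_norm M f \<le> ereal (nrm f)) \<and>
     (\<exists>K0>0. \<forall>f\<in>F. transfer_operator M T f \<in> F \<and> nrm (transfer_operator M T f) \<le> K0 * nrm f) \<and>
     has_spectral_gap M F nrm (transfer_operator M T)"

definition truncated :: "real \<Rightarrow> ('a \<Rightarrow> real) \<Rightarrow> 'a \<Rightarrow> real" where
  "truncated l chi x = chi x * indicator {y. chi y \<le> l} x"

definition property_D ::
  "'a measure \<Rightarrow> ('a \<Rightarrow> 'a) \<Rightarrow> ('a \<Rightarrow> complex) set \<Rightarrow> (('a \<Rightarrow> complex) \<Rightarrow> real) \<Rightarrow>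
   ('a \<Rightarrow> real) \<Rightarrow> bool" where
  "property_D M T F nrm chi \<longleftrightarrow>
     property_C M T F nrm \<and>
     chi \<in> borel_measurable M \<and> (\<forall>x\<in>space M. 0 \<le> chi x) \<and>
     (\<exists>K1>0. \<exists>K2>0. \<forall>l>0.
        (\<lambda>x. complex_of_real (truncated l chi x)) \<in> F \<and>
        nrm (\<lambda>x. complex_of_real (truncated l chi x)) \<le> K1 * l \<and>
        (indicator {x. chi x > l} :: 'a \<Rightarrow> complex) \<in> F \<and>
        nrm (indicator {x. chi x > l}) \<le> K2)"

definition ordering_perm ::
  "('a \<Rightarrow> 'a) \<Rightarrow> ('a \<Rightarrow> real) \<Rightarrow> nat \<Rightarrow> 'a \<Rightarrow> nat \<Rightarrow> nat" where
  "ordering_perm T chi n x =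
     (SOME \<sigma>. \<sigma> permutes {..<n} \<and>
        (\<forall>i j. i \<le> j \<and> j < n \<longrightarrow> chi ((T ^^ \<sigma> i) x) \<ge> chi ((T ^^ \<sigma> j) x)))"

definition trimmed_sum ::
  "('a \<Rightarrow> 'a) \<Rightarrow> ('a \<Rightarrow> real) \<Rightarrow> nat \<Rightarrow> nat \<Rightarrow> 'a \<Rightarrow> real" where
  "trimmed_sum T chi b n x = (\<Sum>k=b..<n. chi ((T ^^ ordering_perm T chi n x k) x))"

end

theory Submission
  imports Defs "HOL-Real_Asymp.Real_Asymp"
begin

text \<open>
  Mixing gives ergodicity.  For a fixed level \<open>l\<close>,
  removing slightly more than \<open>n \<cdot> \<mu>(\<chi> > l)\<close> of the largest terms removes all terms above \<open>l\<close> and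
  only few others, each at most \<open>l\<close>.  By Birkhoff's theorem, applied to the indicator of \<open>\<chi> > l\<close> and
  to \<open>\<chi>\<close> truncated at \<open>l\<close>, the trimmed sum is eventually within a small relative error of
  \<open>n \<cdot> \<integral>\<chi> 1{\<chi> \<le> l} d\<mu>\<close>.  Letting \<open>l\<close> tend to infinity sufficiently slowly with \<open>n\<close>
  makes the removed proportion vanish, and the almost sure convergence survives by the
  Borel--Cantelli lemma.
\<close>

section \<open>Birkhoff's pointwise ergodic theorem\<close>

text \<open>Ergodicity is formulated for strictly invariant sets: the set of unbounded Birkhoff
  sums, to which it is applied, agrees exactly with its preimage.\<close>

locale ergodic_system = prob_space M for M :: "'a measure" +
  fixes T :: "'a \<Rightarrow> 'a"
  assumes T_measurable [measurable]: "T \<in> measurable M M"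
    and distr_T: "distr M M T = M"
    and ergodic: "\<And>A. A \<in> sets M \<Longrightarrow> T -` A \<inter> space M = A \<Longrightarrow> prob A = 0 \<or> prob A = 1"
begin

lemma funpow_measurable [measurable]: "(T ^^ n) \<in> measurable M M"
  by (induction n) (auto intro: measurable_compose)

lemma T_space: "x \<in> space M \<Longrightarrow> T x \<in> space M"
  using T_measurable by (rule measurable_space)

lemma
  fixes f :: "'a \<Rightarrow> real"
  assumes f: "integrable M f"
  shows integrable_comp_T: "integrable M (\<lambda>x. f (T x))"
    and integral_comp_T: "(\<integral>x. f (T x) \<partial>M) = (\<integral>x. f x \<partial>M)"
proof -
  have [measurable]: "f \<in> borel_measurable M"
    using f by simp
  show "integrable M (\<lambda>x. f (T x))"
    using f by (subst (asm) distr_T [symmetric]) (simp add: integrable_distr_eq)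
  show "(\<integral>x. f (T x) \<partial>M) = (\<integral>x. f x \<partial>M)"
    by (subst (2) distr_T [symmetric]) (simp add: integral_distr)
qed

definition birkhoff_sum :: "('a \<Rightarrow> real) \<Rightarrow> nat \<Rightarrow> 'a \<Rightarrow> real" where
  "birkhoff_sum f n x = (\<Sum>i<n. f ((T ^^ i) x))"

lemma birkhoff_sum_0 [simp]: "birkhoff_sum f 0 x = 0"
  by (simp add: birkhoff_sum_def)

lemma birkhoff_sum_Suc: "birkhoff_sum f (Suc n) x = f x + birkhoff_sum f n (T x)"
  unfolding birkhoff_sum_def
  by (subst sum.lessThan_Suc_shift) (simp add: funpow_swap1)

lemma birkhoff_sum_measurable [measurable]:
  assumes [measurable]: "f \<in> borel_measurable M"
  shows "birkhoff_sum f n \<in> borel_measurable M"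
  unfolding birkhoff_sum_def by measurable

lemma birkhoff_sum_diff_const:
  "birkhoff_sum (\<lambda>y. f y - c) n x = birkhoff_sum f n x - real n * c"
  by (simp add: birkhoff_sum_def sum_subtractf)

lemma birkhoff_sum_uminus: "birkhoff_sum (\<lambda>y. - f y) n x = - birkhoff_sum f n x"
  by (simp add: birkhoff_sum_def sum_negf)

text \<open>\<open>birkhoff_max f n\<close> is the maximum of the Birkhoff sums of length \<open>1, \<dots>, n + 1\<close>.\<close>

primrec birkhoff_max :: "('a \<Rightarrow> real) \<Rightarrow> nat \<Rightarrow> 'a \<Rightarrow> real" where
  "birkhoff_max f 0 = f"
| "birkhoff_max f (Suc n) = (\<lambda>x. f x + max 0 (birkhoff_max f n (T x)))"

lemma birkhoff_sum_le_max: "n \<le> m \<Longrightarrow> birkhoff_sum f (Suc n) x \<le> birkhoff_max f m x"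
proof (induction n arbitrary: m x)
  case 0
  show ?case by (cases m) (simp_all add: birkhoff_sum_Suc)
next
  case (Suc n)
  then obtain m' where m': "m = Suc m'" "n \<le> m'"
    by (cases m) auto
  have "birkhoff_sum f (Suc n) (T x) \<le> birkhoff_max f m' (T x)"
    using Suc.IH m'(2) by blast
  then show ?case
    unfolding birkhoff_sum_Suc [of f "Suc n"] m'(1) by simp
qed

lemma birkhoff_max_mono_Suc: "birkhoff_max f n x \<le> birkhoff_max f (Suc n) x"
proof (induction n arbitrary: x)
  case (Suc n)
  show ?case
    unfolding birkhoff_max.simps using Suc [of "T x"] by (simp only: birkhoff_max.simps)
qed simp

lemma birkhoff_max_mono: "n \<le> m \<Longrightarrow> birkhoff_max f n x \<le> birkhoff_max f m x"
  by (rule lift_Suc_mono_le [of "\<lambda>n. birkhoff_max f n x"]) (use birkhoff_max_mono_Suc in auto)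

lemma integrable_birkhoff_max: "integrable M f \<Longrightarrow> integrable M (birkhoff_max f n)"
  by (induction n) (auto intro!: integrable_comp_T)

text \<open>
  The set where the Birkhoff sums are unbounded above is invariant.  If it had full measure, the
  nonnegative integrals of \<open>birkhoff_max f (Suc n) - birkhoff_max f n \<circ> T\<close> would converge to the
  integral of \<open>f\<close>, since the integrands eventually equal \<open>f\<close> there.
\<close>

lemma AE_birkhoff_sum_bounded_above:
  assumes f: "integrable M f" and neg: "(\<integral>x. f x \<partial>M) < 0"
  shows "AE x in M. \<exists>c. \<forall>n. birkhoff_sum f n x \<le> c"
proof -
  have [measurable]: "f \<in> borel_measurable M"
    using f by simp
  \<comment> \<open>Natural thresholds \<open>c\<close> make \<open>A\<close> a countable
    combination of measurable sets; \<open>A_iff\<close> passes to real thresholds.\<close>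
  define A where "A = {x \<in> space M. \<forall>c::nat. \<exists>n. real c < birkhoff_sum f n x}"
  have A [measurable]: "A \<in> sets M"
    unfolding A_def by measurable
  have A_iff: "x \<in> A \<longleftrightarrow> (\<forall>c::real. \<exists>n. c < birkhoff_sum f n x)" if "x \<in> space M" for x
    using that unfolding A_def by (auto) (meson le_less_trans less_imp_le real_arch_simple)
  have step: "(\<forall>c. \<exists>n. c < birkhoff_sum f n x) \<longleftrightarrow> (\<forall>c. \<exists>n. c < birkhoff_sum f n (T x))" for x
  proof (intro iffI allI)
    fix c assume *: "\<forall>c. \<exists>n. c < birkhoff_sum f n x"
    \<comment> \<open>The lower bound 0 forces \<open>n\<close> to be positive, so the first summand
      can be split off.\<close>
    obtain n where n: "max 0 (c + f x) < birkhoff_sum f n x"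
      using * by blast
    then obtain m where "n = Suc m" by (cases n) auto
    with n have "c < birkhoff_sum f m (T x)" by (simp add: birkhoff_sum_Suc)
    then show "\<exists>n. c < birkhoff_sum f n (T x)" ..
  next
    fix c assume *: "\<forall>c. \<exists>n. c < birkhoff_sum f n (T x)"
    obtain n where "c - f x < birkhoff_sum f n (T x)"
      using * by blast
    then have "c < birkhoff_sum f (Suc n) x" by (simp add: birkhoff_sum_Suc)
    then show "\<exists>n. c < birkhoff_sum f n x" ..
  qed
  have "T -` A \<inter> space M = A"
    using A_iff step T_space sets.sets_into_space [OF A] by (auto; blast)
  from ergodic [OF A this] have "prob A = 0"
  proof
    assume "prob A = 1"
    then have AE_A: "AE x in M. x \<in> A"
      using prob_eq_1 [OF A] by simp
    let ?h = "\<lambda>n x. birkhoff_max f (Suc n) x - birkhoff_max f n (T x)"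
    have int: "integrable M (birkhoff_max f n)" for n
      using f by (rule integrable_birkhoff_max)
    note [measurable] = borel_measurable_integrable [OF int]
    \<comment> \<open>The integrand is \<open>f\<close> plus the negative part of
      \<open>birkhoff_max f n\<close> at \<open>T x\<close>.\<close>
    have h_eq: "?h n x = f x + max 0 (- birkhoff_max f n (T x))" for n x
      by (simp add: max_def)
    have "(\<lambda>n. \<integral>x. ?h n x \<partial>M) \<longlonglongrightarrow> (\<integral>x. f x \<partial>M)"
    proof (rule integral_dominated_convergence [where w = "\<lambda>x. \<bar>f x\<bar> + \<bar>f (T x)\<bar>"])
      show "integrable M (\<lambda>x. \<bar>f x\<bar> + \<bar>f (T x)\<bar>)"
        using f integrable_comp_T by auto
      show "AE x in M. (\<lambda>n. ?h n x) \<longlonglongrightarrow> f x"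
        using AE_A
      proof eventually_elim
        case (elim x)
        then have "\<forall>c. \<exists>n. c < birkhoff_sum f n (T x)"
          using A_iff step sets.sets_into_space [OF A] by blast
        then obtain n where n: "0 < birkhoff_sum f n (T x)" by blast
        then obtain m where m: "n = Suc m" by (cases n) auto
        have "0 \<le> birkhoff_max f k (T x)" if "k \<ge> m" for k
          using birkhoff_sum_le_max [OF that, of f "T x"] n m by simp
        then have "\<forall>\<^sub>F k in sequentially. ?h k x = f x"
          unfolding h_eq eventually_sequentially by force
        then show ?case by (rule tendsto_eventually)
      qed
      show "AE x in M. norm (?h n x) \<le> \<bar>f x\<bar> + \<bar>f (T x)\<bar>" for n
      proof (rule AE_I2)
        fix x
        \<comment> \<open>As \<open>birkhoff_max f n\<close> dominates \<open>f\<close>, its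
          negative part at \<open>T x\<close> is at most \<open>\<bar>f (T x)\<bar>\<close>.\<close>
        have "f (T x) \<le> birkhoff_max f n (T x)"
          using birkhoff_max_mono [of 0 n f "T x"] by simp
        then show "norm (?h n x) \<le> \<bar>f x\<bar> + \<bar>f (T x)\<bar>"
          unfolding h_eq
          by (cases "birkhoff_max f n (T x) \<le> 0") (simp_all add: max_def)
      qed
    qed measurable
    moreover have "0 \<le> (\<integral>x. ?h n x \<partial>M)" for n
    proof -
      \<comment> \<open>Invariance of the measure removes \<open>T\<close> from the left integral,
        and \<open>birkhoff_max\<close> grows with its index.\<close>
      have "(\<integral>x. birkhoff_max f n (T x) \<partial>M) \<le> (\<integral>x. birkhoff_max f (Suc n) x \<partial>M)"
        unfolding integral_comp_T [OF int] by (intro integral_mono int birkhoff_max_mono_Suc)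
      then show ?thesis
        using int [of "Suc n"] integrable_comp_T [OF int [of n]]
        by (subst Bochner_Integration.integral_diff) auto
    qed
    ultimately have "0 \<le> (\<integral>x. f x \<partial>M)"
      by (intro LIMSEQ_le_const) auto
    with neg show ?thesis by simp
  qed
  then have "AE x in M. x \<notin> A"
    using prob_eq_0 [OF A] by simp
  then show ?thesis
    using AE_space
  proof eventually_elim
    case (elim x)
    then show ?case using A_iff [of x] by (auto simp: not_less)
  qed
qed

text \<open>Subtracting the mean plus \<open>1 / real (Suc m)\<close> makes the integral negative,
  so the shifted sums are bounded above, and the bound disappears after division by
  \<open>n\<close>. Countably many shifts leave a single null set for all \<open>e\<close>.\<close>

lemma AE_birkhoff_sum_upper:
  assumes f: "integrable M f"
  shows "AE x in M. \<forall>e>0. \<forall>\<^sub>F n in sequentially. birkhoff_sum f n x / n < (\<integral>x. f x \<partial>M) + e"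
proof -
  let ?I = "\<integral>x. f x \<partial>M"
  have "AE x in M. \<exists>c. \<forall>n. birkhoff_sum (\<lambda>x. f x - (?I + 1 / real (Suc m))) n x \<le> c" for m
    by (rule AE_birkhoff_sum_bounded_above) (use f in \<open>auto simp: prob_space\<close>)
  then have "AE x in M. \<forall>m. \<exists>c. \<forall>n. birkhoff_sum (\<lambda>x. f x - (?I + 1 / real (Suc m))) n x \<le> c"
    by (subst AE_all_countable) blast
  then show ?thesis
  proof eventually_elim
    case (elim x)
    show ?case
    proof (intro allI impI)
      fix e :: real assume e: "e > 0"
      \<comment> \<open>One half of \<open>e\<close> pays for the shift, the other half for
        \<open>c / n\<close>.\<close>
      then obtain m where m: "1 / real (Suc m) < e / 2"
        using nat_approx_posE [of "e / 2"] by auto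
      obtain c where c: "\<And>n. birkhoff_sum (\<lambda>x. f x - (?I + 1 / real (Suc m))) n x \<le> c"
        using elim by blast
      have "\<forall>\<^sub>F n in sequentially. real n > max 0 (2 * c / e)"
        by real_asymp
      then show "\<forall>\<^sub>F n in sequentially. birkhoff_sum f n x / n < ?I + e"
      proof eventually_elim
        case (elim n)
        then have n: "real n > 0" "c < real n * (e / 2)"
          using e by (auto simp: field_simps)
        have "birkhoff_sum f n x \<le> c + real n * (?I + 1 / real (Suc m))"
          using c [of n] unfolding birkhoff_sum_diff_const by simp
        also have "\<dots> < real n * (e / 2) + real n * (?I + e / 2)"
          using n m by (intro add_strict_mono mult_strict_left_mono add_strict_left_mono) auto
        finally show ?case
          using n by (simp add: field_simps)
      qed
    qed
  qed
qed

text \<open>The upper bound for \<open>- f\<close> is the matching lower bound for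
  \<open>f\<close>.\<close>

theorem birkhoff:
  assumes f: "integrable M f"
  shows "AE x in M. (\<lambda>n. birkhoff_sum f n x / n) \<longlonglongrightarrow> (\<integral>x. f x \<partial>M)"
proof -
  have "integrable M (\<lambda>x. - f x)"
    using f by simp
  from AE_birkhoff_sum_upper [OF this] AE_birkhoff_sum_upper [OF f] show ?thesis
  proof eventually_elim
    case (elim x)
    show ?case
    proof (rule tendstoI)
      fix e :: real assume "e > 0"
      with elim have
        "\<forall>\<^sub>F n in sequentially. birkhoff_sum (\<lambda>x. - f x) n x / n < (\<integral>x. - f x \<partial>M) + e"
        "\<forall>\<^sub>F n in sequentially. birkhoff_sum f n x / n < (\<integral>x. f x \<partial>M) + e"
        by blast+
      then show "\<forall>\<^sub>F n in sequentially. dist (birkhoff_sum f n x / n) (\<integral>x. f x \<partial>M) < e"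
        by eventually_elim (auto simp: birkhoff_sum_uminus dist_real_def abs_less_iff)
    qed
  qed
qed

end

section \<open>Ergodicity from mixing\<close>

text \<open>All iterated preimages of a strictly invariant \<open>A\<close> equal \<open>A\<close>,
  so the mixing limit reads \<open>prob A = prob A * prob A\<close>.\<close>

lemma mixing_imp_ergodic_system:
  assumes "prob_space M" "invariant_measure M T" "mixing M T"
  shows "ergodic_system M T"
proof -
  interpret prob_space M by fact
  have T: "T \<in> measurable M M" "distr M M T = M"
    using assms(2) by (auto simp: invariant_measure_def)
  show ?thesis
  proof (unfold_locales, fact T(1), fact T(2))
    fix A assume A: "A \<in> sets M" and inv: "T -` A \<inter> space M = A"
    have pre: "(T ^^ n) -` A \<inter> space M = A" for n
    proof (induction n)
      case 0
      show ?case using sets.sets_into_space [OF A] by auto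
    next
      case (Suc n)
      have "(T ^^ Suc n) -` A \<inter> space M = T -` ((T ^^ n) -` A \<inter> space M) \<inter> space M"
        using measurable_space [OF T(1)] by (auto simp: funpow_swap1)
      also have "\<dots> = A" by (simp only: Suc inv)
      finally show ?case .
    qed
    have "(\<lambda>n. prob (A \<inter> ((T ^^ n) -` A \<inter> space M))) \<longlonglongrightarrow> prob A * prob A"
      using assms(3) A unfolding mixing_def by blast
    then have "prob A = prob A * prob A"
      unfolding pre by (simp add: LIMSEQ_const_iff)
    then show "prob A = 0 \<or> prob A = 1" by simp
  qed
qed

section \<open>Diagonal choice of slowly growing levels\<close>

text \<open>A level \<open>k \<ge> 1\<close> is used only from a time \<open>N k\<close> on, after
  which \<open>P k\<close> ever fails with probability below \<open>(1/2) ^ k\<close>. These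
  probabilities are summable, so by Borel-Cantelli almost every point sees such failures at only
  finitely many levels.\<close>

lemma (in prob_space) AE_eventually_diagonal:
  fixes P :: "nat \<Rightarrow> nat \<Rightarrow> 'a \<Rightarrow> bool"
  assumes [measurable]: "\<And>k n. Measurable.pred M (P k n)"
    and ev: "\<And>k. AE x in M. \<forall>\<^sub>F n in sequentially. P k n x"
  shows "\<exists>\<kappa>. filterlim \<kappa> at_top sequentially \<and> (AE x in M. \<forall>\<^sub>F n in sequentially. P (\<kappa> n) n x)"
proof -
  \<comment> \<open>\<open>B k m\<close> collects the points at which \<open>P k\<close> still fails
    at or after time \<open>m\<close>; it decreases to a null set as \<open>m\<close> grows.\<close>
  define B where "B k m = {x \<in> space M. \<exists>n\<ge>m. \<not> P k n x}" for k m
  have [measurable]: "B k m \<in> sets M" for k m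
    unfolding B_def by measurable
  have "(\<lambda>m. prob (B k m)) \<longlonglongrightarrow> prob (\<Inter>m. B k m)" for k
    by (rule finite_Lim_measure_decseq, force, unfold decseq_def B_def, blast intro: order_trans)
  moreover have "prob (\<Inter>m. B k m) = 0" for k
  proof -
    have "AE x in M. x \<notin> (\<Inter>m. B k m)"
      using ev [of k] by eventually_elim (auto simp: B_def eventually_sequentially)
    then show ?thesis by (subst prob_eq_0) auto
  qed
  ultimately have "(\<lambda>m. prob (B k m)) \<longlonglongrightarrow> 0" for k
    by simp
  then have "\<exists>m. prob (B k m) < (1/2) ^ k" for k
  proof -
    assume "\<And>k. (\<lambda>m. prob (B k m)) \<longlonglongrightarrow> 0"
    then have "\<forall>\<^sub>F m in sequentially. prob (B k m) < (1/2) ^ k"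
      by (rule order_tendstoD) simp
    then show ?thesis
      unfolding eventually_sequentially by blast
  qed
  then obtain N where N: "\<And>k. prob (B k (N k)) < (1/2) ^ k"
    by metis
  have "summable (\<lambda>k. prob (B k (N k)))"
    by (rule summable_comparison_test [of _ "\<lambda>k. (1/2) ^ k"])
       (use N in \<open>auto intro!: exI [of _ 0] less_imp_le\<close>)
  then have bc: "AE x in M. \<forall>\<^sub>F k in sequentially. x \<in> space M - B k (N k)"
    by (intro borel_cantelli_AE1) (auto simp: less_top [symmetric])
  define K where "K n = {k. k \<le> n \<and> (k = 0 \<or> N k \<le> n)}" for n
  define \<kappa> where "\<kappa> n = Max (K n)" for n
  have fin: "finite (K n)" for n
    by (rule finite_subset [of _ "{..n}"]) (auto simp: K_def)
  have "0 \<in> K n" for n by (auto simp: K_def)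
  then have \<kappa>_in: "\<kappa> n \<in> K n" for n
    unfolding \<kappa>_def using fin by (intro Max_in) auto
  have \<kappa>_ge: "k \<le> \<kappa> n" if "max k (N k) \<le> n" for k n
    unfolding \<kappa>_def using fin that by (intro Max_ge) (auto simp: K_def)
  have lim: "filterlim \<kappa> at_top sequentially"
    unfolding filterlim_at_top eventually_sequentially using \<kappa>_ge by blast
  from bc have "AE x in M. \<forall>\<^sub>F n in sequentially. P (\<kappa> n) n x"
  proof eventually_elim
    case (elim x)
    have "\<forall>\<^sub>F n in sequentially. x \<in> space M - B (\<kappa> n) (N (\<kappa> n))"
      using eventually_compose_filterlim [OF elim lim] .
    \<comment> \<open>Only level 0 may be used too early; from level 1 on, membership in
      \<open>K n\<close> yields \<open>N (\<kappa> n) \<le> n\<close>.\<close>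
    moreover have "\<forall>\<^sub>F n in sequentially. 1 \<le> \<kappa> n"
      using lim unfolding filterlim_at_top by blast
    ultimately show ?case
    proof eventually_elim
      case (elim n)
      then have "N (\<kappa> n) \<le> n"
        using \<kappa>_in [of n] by (auto simp: K_def)
      with elim show ?case by (auto simp: B_def)
    qed
  qed
  with lim show ?thesis by blast
qed

section \<open>Order statistics and trimmed sums\<close>

text \<open>The choice is witnessed by sorting the indices by their negated values and extending by
  the identity from \<open>n\<close> on.\<close>

lemma ordering_perm:
  shows "ordering_perm T chi n x permutes {..<n}"
    and "i \<le> j \<Longrightarrow> j < n \<Longrightarrow>
      chi ((T ^^ ordering_perm T chi n x j) x) \<le> chi ((T ^^ ordering_perm T chi n x i) x)"
proof -
  define a where "a i = chi ((T ^^ i) x)" for i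
  define xs where "xs = sort_key (\<lambda>i. - a i) [0..<n]"
  have xs: "length xs = n" "distinct xs" "set xs = {..<n}"
    unfolding xs_def length_sort distinct_sort set_sort length_upt set_upt lessThan_atLeast0
    by (rule diff_zero distinct_upt refl)+
  define \<sigma> where "\<sigma> i = (if i < n then xs ! i else i)" for i
  have "bij_betw ((!) xs) {..<n} {..<n}"
    by (rule bij_betw_nth) (simp_all only: xs)
  moreover have "bij_betw ((!) xs) {..<n} {..<n} = bij_betw \<sigma> {..<n} {..<n}"
    by (rule bij_betw_cong) (simp add: \<sigma>_def)
  ultimately have "bij_betw \<sigma> {..<n} {..<n}"
    by simp
  then have 1: "\<sigma> permutes {..<n}"
    by (rule bij_imp_permutes) (auto simp: \<sigma>_def)
  have "sorted (map (\<lambda>i. - a i) xs)"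
    unfolding xs_def by (rule sorted_sort_key)
  then have 2: "a (\<sigma> j) \<le> a (\<sigma> i)" if "i \<le> j" "j < n" for i j
    using sorted_nth_mono [of "map (\<lambda>i. - a i) xs" i j] xs that by (simp add: \<sigma>_def)
  have "ordering_perm T chi n x permutes {..<n} \<and> (\<forall>i j. i \<le> j \<and> j < n \<longrightarrow>
      chi ((T ^^ ordering_perm T chi n x i) x) \<ge> chi ((T ^^ ordering_perm T chi n x j) x))"
    unfolding ordering_perm_def
    by (rule someI [of _ \<sigma>]) (use 1 2 in \<open>simp add: a_def\<close>)
  then show "ordering_perm T chi n x permutes {..<n}"
    and "i \<le> j \<Longrightarrow> j < n \<Longrightarrow>
      chi ((T ^^ ordering_perm T chi n x j) x) \<le> chi ((T ^^ ordering_perm T chi n x i) x)"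
    by blast+
qed

text \<open>The indices with values above \<open>l\<close> form an initial segment, which is
  determined by its cardinality.\<close>

lemma antitone_above_iff:
  fixes s :: "nat \<Rightarrow> real"
  assumes anti: "\<And>i j. i \<le> j \<Longrightarrow> j < n \<Longrightarrow> s j \<le> s i" and k: "k < n"
  shows "s k > l \<longleftrightarrow> k < card {i\<in>{..<n}. s i > l}"
proof
  assume "s k > l"
  then have "i < n" "s i > l" if "i \<le> k" for i
    using anti [of i k] that k by linarith+
  then have "{..k} \<subseteq> {i\<in>{..<n}. s i > l}"
    by auto
  then have "card {..k} \<le> card {i\<in>{..<n}. s i > l}"
    by (intro card_mono) auto
  then show "k < card {i\<in>{..<n}. s i > l}" by simp
next
  assume *: "k < card {i\<in>{..<n}. s i > l}"
  show "s k > l"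
  proof (rule ccontr)
    assume "\<not> s k > l"
    then have "i < k" if "i < n" "s i > l" for i
      using anti [of k i] that by linarith
    then have "{i\<in>{..<n}. s i > l} \<subseteq> {..<k}"
      by auto
    then have "card {i\<in>{..<n}. s i > l} \<le> card {..<k}"
      by (intro card_mono) auto
    with * show False by simp
  qed
qed

text \<open>In decreasing order, truncation drops exactly the values above \<open>l\<close>, which
  come first, while trimming drops the first \<open>b\<close> values. The two sums differ by the
  ranks in between, whose values lie between 0 and \<open>l\<close>.\<close>

lemma trimmed_sum_bounds:
  assumes l: "l \<ge> 0" and nn: "\<And>i. i < n \<Longrightarrow> chi ((T ^^ i) x) \<ge> 0"
    and b: "card {i\<in>{..<n}. chi ((T ^^ i) x) > l} \<le> b"
  shows "trimmed_sum T chi b n x \<le> (\<Sum>i<n. truncated l chi ((T ^^ i) x))"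
    and "(\<Sum>i<n. truncated l chi ((T ^^ i) x))
      \<le> trimmed_sum T chi b n x + l * (real b - card {i\<in>{..<n}. chi ((T ^^ i) x) > l})"
proof -
  let ?\<sigma> = "ordering_perm T chi n x"
  define a where "a i = chi ((T ^^ i) x)" for i
  define N where "N = card {i\<in>{..<n}. a i > l}"
  define s where "s k = a (?\<sigma> k)" for k
  have perm: "?\<sigma> permutes {..<n}" by (rule ordering_perm)
  have anti: "s j \<le> s i" if "i \<le> j" "j < n" for i j
    using ordering_perm(2) [OF that] by (simp add: s_def a_def)
  have snn: "s i \<ge> 0" if "i < n" for i
    using permutes_in_image [OF perm, of i] that nn by (simp add: s_def a_def)
  \<comment> \<open>The permutation matches ranks with times, so both count the same number
    \<open>N\<close> of values above \<open>l\<close>.\<close>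
  have "?\<sigma> ` {i\<in>{..<n}. s i > l} = {i\<in>{..<n}. a i > l}"
  proof -
    have "\<exists>j<n. i = ?\<sigma> j" if "i < n" for i
      using permutes_image [OF perm] that by (metis imageE lessThan_iff)
    then show ?thesis
      using permutes_in_image [OF perm] by (auto simp: s_def image_iff)
  qed
  then have N: "N = card {i\<in>{..<n}. s i > l}"
    unfolding N_def by (metis card_image permutes_inj_on [OF perm])
  have Nn: "N \<le> n"
    using card_mono [of "{..<n}" "{i\<in>{..<n}. s i > l}"] by (auto simp: N)
  have big: "s k > l \<longleftrightarrow> k < N" if "k < n" for k
    unfolding N using anti that by (rule antitone_above_iff)
  have "(\<Sum>i<n. truncated l chi ((T ^^ i) x)) = (\<Sum>i<n. if a i \<le> l then a i else 0)"
    by (intro sum.cong) (auto simp: truncated_def a_def)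
  also have "\<dots> = (\<Sum>k<n. if s k \<le> l then s k else 0)"
    using sum.permute [OF perm, of "\<lambda>i. if a i \<le> l then a i else 0"]
    by (simp add: s_def o_def cong: if_cong)
  also have "\<dots> = (\<Sum>k\<in>{..<n}. if k \<in> {N..<n} then s k else 0)"
    using big by (intro sum.cong) (auto simp: not_less [symmetric])
  also have "\<dots> = (\<Sum>k=N..<n. s k)"
    by (subst sum.inter_restrict [symmetric]) (auto intro!: sum.cong)
  finally have trunc: "(\<Sum>i<n. truncated l chi ((T ^^ i) x)) = (\<Sum>k=N..<n. s k)" .
  have trim: "trimmed_sum T chi b n x = (\<Sum>k=b..<n. s k)"
    by (simp add: trimmed_sum_def s_def a_def)
  have Nb: "N \<le> b"
    using b by (simp add: N_def a_def)
  show "trimmed_sum T chi b n x \<le> (\<Sum>i<n. truncated l chi ((T ^^ i) x))"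
    unfolding trim trunc using Nb snn by (intro sum_mono2) auto
  \<comment> \<open>The minimum covers \<open>b > n\<close>, where trimming leaves the empty
    sum.\<close>
  have "(\<Sum>k=N..<n. s k) = (\<Sum>k=N..<min b n. s k) + (\<Sum>k=min b n..<n. s k)"
    using Nb Nn by (simp add: sum.atLeastLessThan_concat)
  also have "(\<Sum>k=min b n..<n. s k) = (\<Sum>k=b..<n. s k)"
    by (cases "b \<le> n") auto
  also have "(\<Sum>k=N..<min b n. s k) \<le> real (card {N..<min b n}) * l"
    using big by (intro sum_bounded_above) (auto simp: not_less [symmetric])
  also have "\<dots> \<le> (real b - N) * l"
    using l Nb Nn by (intro mult_right_mono) auto
  finally show "(\<Sum>i<n. truncated l chi ((T ^^ i) x))
      \<le> trimmed_sum T chi b n x + l * (real b - card {i\<in>{..<n}. chi ((T ^^ i) x) > l})"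
    unfolding trim trunc using N_def a_def by (simp add: mult.commute)
qed

section \<open>Strong law for trimmed sums\<close>

lemma (in ergodic_system) strong_law_trimmed_sums:
  fixes chi :: "'a \<Rightarrow> real"
  assumes [measurable]: "chi \<in> borel_measurable M"
    and nn: "\<And>x. x \<in> space M \<Longrightarrow> 0 \<le> chi x"
    and nonzero: "\<not> (AE x in M. chi x = 0)"
  shows "\<exists>(b :: nat \<Rightarrow> nat) (d :: nat \<Rightarrow> real).
           (\<forall>n. 0 < b n) \<and> (\<lambda>n. real (b n)) \<in> o(\<lambda>n. real n) \<and> (\<forall>n. 0 < d n) \<and>
           (AE x in M. (\<lambda>n. trimmed_sum T chi (b n) n x / d n) \<longlonglongrightarrow> 1)"
proof -
  have [measurable]: "truncated l chi \<in> borel_measurable M" for l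
    unfolding truncated_def by measurable
  have trunc_bounds: "0 \<le> truncated l chi x" "truncated l chi x \<le> max 0 l" if "x \<in> space M" for l x
    using nn [OF that] by (auto simp: truncated_def indicator_def)
  have int_trunc: "integrable M (truncated l chi)" for l
    by (rule integrable_const_bound [where B = "max 0 l"]) (use trunc_bounds in auto)
  define I where "I l = (\<integral>x. truncated l chi x \<partial>M)" for l
  have I_mono: "I l \<le> I l'" if "l \<le> l'" for l l'
    unfolding I_def by (intro integral_mono int_trunc)
      (use that nn in \<open>auto simp: truncated_def indicator_def\<close>)
  \<comment> \<open>If all truncated means were zero, every truncation would vanish almost
    everywhere. Then so would \<open>chi\<close>, since each of its values lies below some integer
    level.\<close>
  have "\<exists>k0. I (real k0) > 0"
  proof (rule ccontr)
    assume "\<nexists>k0. I (real k0) > 0"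
    moreover have "I l \<ge> 0" for l
      unfolding I_def by (intro Bochner_Integration.integral_nonneg_AE AE_I2 trunc_bounds)
    ultimately have "I (real k) = 0" for k
      by (meson antisym not_less)
    then have "AE x in M. truncated (real k) chi x = 0" for k
      using integral_nonneg_eq_0_iff_AE [OF int_trunc] trunc_bounds(1) by (auto simp: I_def)
    then have "AE x in M. \<forall>k::nat. truncated (real k) chi x = 0"
      by (simp add: AE_all_countable)
    then have "AE x in M. chi x = 0"
    proof eventually_elim
      case (elim x)
      obtain k where "chi x \<le> real k" using real_arch_simple by blast
      then show ?case using elim [rule_format, of k] by (auto simp: truncated_def)
    qed
    with nonzero show False by simp
  qed
  then obtain k0 where k0: "I (real k0) > 0" by blast
  \<comment> \<open>The shift by \<open>k0\<close> keeps every truncated mean \<open>m k\<close> at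
    least \<open>I (real k0)\<close>, hence positive.\<close>
  define l where "l k = real (Suc k + k0)" for k
  define m where "m k = I (l k)" for k
  define p where "p k = prob {x \<in> space M. chi x > l k}" for k
  \<comment> \<open>The second bound keeps the at most \<open>2\<delta>n + 1\<close> additionally removed terms, of size at most
    \<open>l\<close> each, negligible against \<open>n m\<close>.\<close>
  define \<delta> where "\<delta> k = min (1 / real (Suc k)) (m k / (real (Suc k) * l k))" for k
  \<comment> \<open>An excess proportion \<open>\<delta> k\<close> over the expected
    \<open>p k\<close> ensures that all terms above \<open>l k\<close> are removed although their
    number fluctuates.\<close>
  define c where "c k = p k + \<delta> k" for k
  have l_pos: "l k > 0" for k by (simp add: l_def)
  have m_pos: "m k > 0" for k
    using k0 I_mono [of "real k0" "l k"] by (simp add: m_def l_def)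
  have \<delta>_pos: "\<delta> k > 0" for k
    using l_pos m_pos by (simp add: \<delta>_def)
  have c_pos: "c k > 0" for k
    using \<delta>_pos [of k] by (simp add: c_def p_def add_nonneg_pos)
  have "p \<longlonglongrightarrow> prob (\<Inter>k. {x \<in> space M. chi x > l k})"
    unfolding p_def
    by (rule finite_Lim_measure_decseq) (auto simp: decseq_def l_def)
  moreover have "(\<Inter>k. {x \<in> space M. chi x > l k}) = {}"
  proof -
    have "\<exists>k. chi x \<le> l k" for x
    proof -
      obtain k where "chi x \<le> real k" using real_arch_simple by blast
      then have "chi x \<le> l k" by (simp add: l_def)
      then show ?thesis ..
    qed
    then show ?thesis by (auto simp: not_less [symmetric])
  qed
  ultimately have p_lim: "p \<longlonglongrightarrow> 0" by simp
  have "\<delta> \<longlonglongrightarrow> 0"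
  proof (rule tendsto_sandwich [of "\<lambda>_. 0" _ _ "\<lambda>k. 1 / real (Suc k)"])
    show "\<forall>\<^sub>F k in sequentially. 0 \<le> \<delta> k" using \<delta>_pos by (intro always_eventually allI less_imp_le)
    show "\<forall>\<^sub>F k in sequentially. \<delta> k \<le> 1 / real (Suc k)" by (simp add: \<delta>_def)
    show "(\<lambda>k. 1 / real (Suc k)) \<longlonglongrightarrow> 0" by real_asymp
  qed simp
  with p_lim have c_lim: "c \<longlonglongrightarrow> 0"
    unfolding c_def using tendsto_add by fastforce
  let ?ind = "\<lambda>k x. indicator {x. chi x > l k} x :: real"
  \<comment> \<open>The bound on \<open>real n * m k\<close> lets one term of size
    \<open>l k\<close> be absorbed with relative error \<open>1 / real (Suc k)\<close>; the last two
    conditions are the Birkhoff estimates.\<close>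
  define P where "P k n x \<longleftrightarrow> real n \<ge> 1 \<and> real n * m k \<ge> real (Suc k) * l k \<and>
      \<bar>birkhoff_sum (?ind k) n x / n - p k\<bar> < \<delta> k \<and>
      \<bar>birkhoff_sum (truncated (l k) chi) n x / n - m k\<bar> < m k / real (Suc k)" for k n x
  have [measurable]: "?ind k \<in> borel_measurable M" for k
    by measurable
  have "Measurable.pred M (P k n)" for k n
    unfolding P_def by measurable
  moreover have "AE x in M. \<forall>\<^sub>F n in sequentially. P k n x" for k
  proof -
    have "integrable M (?ind k)"
      by (rule integrable_const_bound [where B = 1]) (auto simp: indicator_def)
    from birkhoff [OF this] birkhoff [OF int_trunc [of "l k"]] show ?thesis
    proof eventually_elim
      case (elim x)
      have "(\<integral>x. ?ind k x \<partial>M) = (\<integral>x. indicator {x \<in> space M. chi x > l k} x \<partial>M)"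
        by (intro Bochner_Integration.integral_cong) (auto simp: indicator_def)
      also have "\<dots> = p k" by (simp add: p_def)
      finally have "\<forall>\<^sub>F n in sequentially. \<bar>birkhoff_sum (?ind k) n x / n - p k\<bar> < \<delta> k"
        using tendstoD [OF elim(1) \<delta>_pos [of k]] by (simp add: dist_real_def)
      moreover have "\<forall>\<^sub>F n in sequentially.
          \<bar>birkhoff_sum (truncated (l k) chi) n x / n - m k\<bar> < m k / real (Suc k)"
        using tendstoD [OF elim(2), of "m k / real (Suc k)"] m_pos [of k]
        by (simp add: dist_real_def m_def I_def)
      moreover have "\<forall>\<^sub>F n in sequentially. real n \<ge> max 1 (real (Suc k) * l k / m k)"
        by real_asymp
      ultimately show ?case
        by eventually_elim (use m_pos [of k] in \<open>simp add: P_def field_simps\<close>)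
    qed
  qed
  ultimately obtain \<kappa> where \<kappa>: "filterlim \<kappa> at_top sequentially"
    and P: "AE x in M. \<forall>\<^sub>F n in sequentially. P (\<kappa> n) n x"
    using AE_eventually_diagonal [of P] by blast
  \<comment> \<open>The ceiling costs at most one extra term; the maximum with 1, like the value 1
    of \<open>d 0\<close>, secures positivity at \<open>n = 0\<close>.\<close>
  define b where "b n = max 1 (nat \<lceil>c (\<kappa> n) * real n\<rceil>)" for n
  define d where "d n = (if n = 0 then 1 else real n * m (\<kappa> n))" for n
  have b_le: "real (b n) \<le> c (\<kappa> n) * real n + 1" for n
  proof -
    have "0 \<le> c (\<kappa> n) * real n" using c_pos [of "\<kappa> n"] by simp
    then show ?thesis unfolding b_def by linarith
  qed
  have b_ge: "real (b n) \<ge> c (\<kappa> n) * real n" for n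
    unfolding b_def by linarith
  have "(\<lambda>n. real (b n)) \<in> o(\<lambda>n. real n)"
  proof (rule smalloI_tendsto)
    have inv: "(\<lambda>n. 1 / real n) \<longlonglongrightarrow> 0"
      by real_asymp
    have lim: "(\<lambda>n. c (\<kappa> n) + 1 / real n) \<longlonglongrightarrow> 0"
      using tendsto_add [OF filterlim_compose [OF c_lim \<kappa>] inv] by simp
    show "(\<lambda>n. real (b n) / real n) \<longlonglongrightarrow> 0"
    proof (rule tendsto_sandwich [of "\<lambda>_. 0" _ _ "\<lambda>n. c (\<kappa> n) + 1 / real n"])
      show "\<forall>\<^sub>F n in sequentially. real (b n) / real n \<le> c (\<kappa> n) + 1 / real n"
        using eventually_gt_at_top [of 0]
        by eventually_elim (use b_le in \<open>simp add: field_simps\<close>)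
    qed (use lim in auto)
    show "\<forall>\<^sub>F n in sequentially. real n \<noteq> 0"
      using eventually_gt_at_top [of 0] by eventually_elim simp
  qed
  moreover have "AE x in M. (\<lambda>n. trimmed_sum T chi (b n) n x / d n) \<longlonglongrightarrow> 1"
    using P AE_space
  proof eventually_elim
    case (elim x)
    have "\<forall>\<^sub>F n in sequentially.
        \<bar>trimmed_sum T chi (b n) n x / d n - 1\<bar> \<le> 4 / real (Suc (\<kappa> n))"
      using elim(1)
    proof eventually_elim
      case (elim n)
      define k where "k = \<kappa> n"
      define N where "N = card {i\<in>{..<n}. chi ((T ^^ i) x) > l k}"
      define \<tau> where "\<tau> = (\<Sum>i<n. truncated (l k) chi ((T ^^ i) x))"
      define S where "S = trimmed_sum T chi (b n) n x"
      \<comment> \<open>\<open>q\<close> is the unit of error: one \<open>q\<close> for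
        \<open>\<tau>\<close> against \<open>n * m k\<close>, two for the excess of removed terms
        and one for rounding, in total \<open>4 * q\<close>.\<close>
      define q where "q = real n * m k / real (Suc k)"
      have n: "real n \<ge> 1" "real n > 0" and large: "real n * m k \<ge> real (Suc k) * l k"
        using elim by (auto simp: P_def k_def)
      have "birkhoff_sum (?ind k) n x = N"
        by (simp add: birkhoff_sum_def N_def indicator_def sum.If_cases Int_def)
      then have "\<bar>N / n - p k\<bar> < \<delta> k"
        using elim by (simp add: P_def k_def)
      then have N: "\<bar>N - p k * n\<bar> < \<delta> k * n"
        using n by (simp add: abs_less_iff field_simps)
      have "\<bar>\<tau> / n - m k\<bar> < m k / real (Suc k)"
        using elim by (simp add: P_def k_def \<tau>_def birkhoff_sum_def)
      then have "\<bar>\<tau> / n - m k\<bar> * n < m k / real (Suc k) * n"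
        using n by (intro mult_strict_right_mono) auto
      moreover have "\<bar>\<tau> / n - m k\<bar> * n = \<bar>(\<tau> / n - m k) * n\<bar>"
        by (simp add: abs_mult)
      moreover have "(\<tau> / n - m k) * n = \<tau> - n * m k"
        using n by (simp add: field_simps)
      ultimately have \<tau>: "\<bar>\<tau> - n * m k\<bar> < q"
        by (simp add: q_def mult.commute)
      have b: "c k * n \<le> b n" "b n \<le> c k * n + 1"
        using b_le b_ge by (auto simp: k_def)
      have Nb: "N \<le> b n"
        using N b(1) by (simp add: c_def distrib_right abs_less_iff)
      \<comment> \<open>\<open>b n\<close> exceeds \<open>p k * n\<close> by at most
        \<open>\<delta> k * n + 1\<close>, and \<open>N\<close> falls short of it by less than
        \<open>\<delta> k * n\<close>.\<close>
      have "real (b n) - N \<le> 2 * \<delta> k * n + 1"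
        using N b(2) by (simp add: c_def distrib_right abs_less_iff)
      then have "l k * (real (b n) - N) \<le> l k * (2 * \<delta> k * n + 1)"
        using l_pos [of k] by (intro mult_left_mono) auto
      also have "\<dots> = 2 * n * (l k * \<delta> k) + l k"
        by (simp add: algebra_simps)
      also have "l k * \<delta> k \<le> l k * (m k / (real (Suc k) * l k))"
        using l_pos [of k] by (intro mult_left_mono) (auto simp: \<delta>_def)
      also have "\<dots> = m k / real (Suc k)"
        using l_pos [of k] by simp
      finally have "l k * (real (b n) - N) \<le> 2 * q + l k"
        using n by (simp add: q_def mult_left_mono)
      moreover have "l k \<le> q"
        using large by (simp add: q_def field_simps)
      ultimately have gap: "l k * (real (b n) - N) \<le> 3 * q"
        by simp
      have orbit: "chi ((T ^^ i) x) \<ge> 0" for i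
        using nn measurable_space [OF funpow_measurable \<open>x \<in> space M\<close>] by blast
      have "S \<le> \<tau>" "\<tau> \<le> S + l k * (real (b n) - N)"
        using trimmed_sum_bounds [of "l k" n chi T x "b n"] orbit l_pos [of k] Nb
        unfolding S_def \<tau>_def N_def by auto
      with \<tau> gap have "\<bar>S - n * m k\<bar> \<le> 4 * q"
        by linarith
      moreover have nm: "real n * m k > 0"
        using n m_pos by simp
      ultimately have "\<bar>S - n * m k\<bar> / (n * m k) \<le> 4 * q / (n * m k)"
        by (intro divide_right_mono) auto
      also have "4 * q / (n * m k) = 4 / real (Suc k)"
        using n m_pos [of k] by (simp add: q_def)
      also have "\<bar>S - n * m k\<bar> / (n * m k) = \<bar>S / (n * m k) - 1\<bar>"
      proof -
        have "S / (n * m k) - 1 = (S - n * m k) / (n * m k)"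
          using n m_pos [of k] by (simp add: diff_divide_distrib)
        then show ?thesis using nm by (simp only: abs_divide abs_of_pos)
      qed
      finally show ?case
        using n by (simp add: S_def d_def k_def)
    qed
    moreover have "(\<lambda>n. 4 / real (Suc (\<kappa> n))) \<longlonglongrightarrow> 0"
      by (rule filterlim_compose [OF _ \<kappa>, of "\<lambda>k. 4 / real (Suc k)"]) real_asymp
    ultimately have "(\<lambda>n. trimmed_sum T chi (b n) n x / d n - 1) \<longlonglongrightarrow> 0"
      unfolding real_norm_def [symmetric] by (rule Lim_null_comparison)
    then show ?case
      by (simp add: LIM_zero_iff)
  qed
  moreover have "0 < b n" "0 < d n" for n
    using m_pos by (auto simp: b_def d_def)
  ultimately show ?thesis by blast
qed

theorem corollary1p5:
  fixes M :: "'a measure" and T :: "'a \<Rightarrow> 'a"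
    and F :: "('a \<Rightarrow> complex) set" and nrm :: "('a \<Rightarrow> complex) \<Rightarrow> real"
    and chi :: "'a \<Rightarrow> real"
  assumes "property_D M T F nrm chi"
    and "(\<integral>\<^sup>+x. ennreal (chi x) \<partial>M) = \<infinity>"
  shows "\<exists>(b :: nat \<Rightarrow> nat) (d :: nat \<Rightarrow> real).
           (\<forall>n. 0 < b n) \<and>
           (\<lambda>n. real (b n)) \<in> o(\<lambda>n. real n) \<and>
           (\<forall>n. 0 < d n) \<and>
           (AE x in M. (\<lambda>n. trimmed_sum T chi (b n) n x / d n) \<longlonglongrightarrow> 1)"
proof -
  have C: "property_C M T F nrm" and chi: "chi \<in> borel_measurable M" "\<forall>x\<in>space M. 0 \<le> chi x"
    using assms(1) unfolding property_D_def by blast+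
  have "prob_space M" "invariant_measure M T" "mixing M T"
    using C unfolding property_C_def by blast+
  then interpret ergodic_system M T
    by (rule mixing_imp_ergodic_system)
  \<comment> \<open>The infinite integral supplies the nontriviality that makes the normalising
    sequence positive.\<close>
  have "\<not> (AE x in M. chi x = 0)"
  proof
    assume "AE x in M. chi x = 0"
    then have "(\<integral>\<^sup>+x. ennreal (chi x) \<partial>M) = (\<integral>\<^sup>+x. 0 \<partial>M)"
      by (intro nn_integral_cong_AE) auto
    with assms(2) show False by simp
  qed
  with chi show ?thesis
    by (intro strong_law_trimmed_sums) auto
qed

end
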